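(* Let $\mathtt r\le \mathtt r_0$ and suppose that the following two conditions hold for this $\mathtt r$. (i) There is a constant $\omega(\mathtt r)\in[0,1/2]$ such that for all $\theta\in\Theta_0(\mathtt r)$ and all $|\lambda|\le \mathtt g$, $$\sup_{\gamma\in\mathbb R^p\setminus\{0\}}\log \mathbb E\exp\Big\{\lambda\,\frac{\gamma^\top\{\nabla\zeta(\theta)-\nabla\zeta(\theta^* )\}}{\omega(\mathtt r)\,\|V_0\gamma\|}\Big\}\le \frac{\nu_0^2\lambda^2}{2}.$$ (ii) There are a symmetric strictly positive-definite matrix $D_0^2$ and a constant $\delta(\mathtt r)\in[0,1/2]$ such that for all $\theta\in\Theta_0(\mathtt r)$, $\theta\neq\theta^*$, $$\Big|\frac{-2\,\mathbb E L(\theta,\theta^* )}{\|D_0(\theta-\theta^* )\|^2}-1\Big|\le\delta(\mathtt r).$$ Let $\varrho\ge 3\nu_0\,\omega(\mathtt r)$ and $\delta\ge\delta(\mathtt r)$ be such that $D_\epsilon^2=D_0^2(1-\delta)-\varrho V_0^2$ is positive definite, $\epsilon=(\delta,\varrho)$, $\underline\epsilon=-\epsilon$. Let $$C_\epsilon(\mathtt r)=\{\tilde\theta\in\Theta_0(\mathtt r),\ \|V_0D_{\underline\epsilon}^{-1}\xi_{\underline\epsilon}\|\le\mathtt r\}.$$ Then for any $z>0$ $$\mathbb P\{\|D_\epsilon(\tilde\theta-\theta^* )\|>z,\ C_\epsilon(\mathtt r)\}\le\mathbb P\Big\{\|\xi_\epsilon\|>z-\sqrt{2\Delta_\epsilon(\mathtt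 r)}\Big\}.$$
   Context: Setting. $\Theta\subseteq\mathbb R^p$. The data $Y$ have a distribution $\mathbb P$ with expectation $\mathbb E$. $L(\theta)=L(Y,\theta)$, $\theta\in\Theta$, is a random function (a quasi log-likelihood; $\mathbb P$ need not belong to any parametric family). Put $L(\theta,\theta')=L(\theta)-L(\theta')$. The quasi maximum likelihood estimator $\tilde\theta=\arg\max_{\theta\in\Theta}L(\theta)$ is assumed to exist (the maximum is attained; if not unique, $\tilde\theta$ is any maximizer). The target is $\theta^*=\arg\max_{\theta\in\Theta}\mathbb E L(\theta)$, and $\nabla\mathbb E L(\theta^* )=0$. The stochastic component $\zeta(\theta)=L(\theta)-\mathbb E L(\theta)$ is differentiable in $\theta$; thus $\nabla L(\theta^* )=\nabla\zeta(\theta^* )$. $V_0^2$ is a symmetric positive-definite $p\times p$ matrix (with symmetric root $V_0$), $\mathtt g>0$, $\nu_0\ge1$ and $\mathtt r_0>0$ are constants. The local set is $\Theta_0(\mathtt r)=\{\theta:\|V_0(\theta-\theta^* )\|\le \mathtt r\}$, a full ellipsoid contained in $\Theta$ for $\mathtt r\le\mathtt r_0$. When $\omega(\mathtt r)=0$, condition (i) means $\nabla\zeta(\theta)=\nabla\zeta(\theta^* )$ on $\Theta_0(\mathtt r)$. $D_{\underline\epsilon}^2=D_0^2(1+\delta)+\varrho V_0^2$; $\xi_\epsilon=D_\epsilon^{-1}\nabla L(\theta^* )$, $\xi_{\underline\epsilon}=D_{\underline\epsilon}^{-1}\nabla L(\theta^* )$ (symmetric positive-definite roots). With $\zeta(\theta,\theta^*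 )=\zeta(\theta)-\zeta(\theta^* )$, $$\Diamond_{\epsilon}(\mathtt r)=\sup_{\theta\in\Theta_0(\mathtt r)}\Big\{\zeta(\theta,\theta^* )-(\theta-\theta^* )^\top\nabla\zeta(\theta^* )-\tfrac{\varrho}{2}\|V_0(\theta-\theta^* )\|^2\Big\},$$ $$\Diamond_{\underline\epsilon}(\mathtt r)=\sup_{\theta\in\Theta_0(\mathtt r)}\Big\{-\zeta(\theta,\theta^* )+(\theta-\theta^* )^\top\nabla\zeta(\theta^* )-\tfrac{\varrho}{2}\|V_0(\theta-\theta^* )\|^2\Big\}.$$ The spread is $\Delta_\epsilon(\mathtt r)=\Diamond_\epsilon(\mathtt r)+\Diamond_{\underline\epsilon}(\mathtt r)+(\|\xi_\epsilon\|^2-\|\xi_{\underline\epsilon}\|^2)/2$. *)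

theory Defs
  imports "HOL-Probability.Probability"
begin

definition sym_pos_def :: "real^'n^'n \<Rightarrow> bool" where
  "sym_pos_def A \<longleftrightarrow> transpose A = A \<and> (\<forall>x. x \<noteq> 0 \<longrightarrow> 0 < x \<bullet> (A *v x))"

text \<open>Every symmetric positive-definite matrix has exactly one symmetric positive-definite root,
  so the description below is proper for such matrices; it is unspecified otherwise.\<close>

definition mat_sqrt :: "real^'n^'n \<Rightarrow> real^'n^'n" where
  "mat_sqrt A = (THE R. sym_pos_def R \<and> R ** R = A)"

text \<open>Gradient relative to a set \<open>S\<close>. The likelihood is only given on the parameter set, whose
  boundary the local ellipsoid may touch, so derivatives are taken within that set. They are
  uniquely determined at every point of an ellipsoid of positive radius contained in \<open>S\<close>, and
  they are the ordinary ones at interior points.\<close>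

definition grad :: "(real^'n) set \<Rightarrow> (real^'n \<Rightarrow> real) \<Rightarrow> real^'n \<Rightarrow> real^'n" where
  "grad S f x = (\<chi> i. frechet_derivative f (at x within S) (axis i 1))"

text \<open>\<open>log E exp X\<close> as an extended real; it is infinite when \<open>exp X\<close> is not integrable.\<close>

definition log_exp_moment :: "'a measure \<Rightarrow> ('a \<Rightarrow> real) \<Rightarrow> ereal" where
  "log_exp_moment M X =
     (if integrable M (\<lambda>y. exp (X y)) then ereal (ln (\<integral>y. exp (X y) \<partial>M)) else \<infinity>)"

text \<open>In what follows \<open>M\<close> is the distribution of the data on the observation space, \<open>L y \<theta>\<close> is the
  quasi log-likelihood at the observation \<open>y\<close>, and \<open>V2\<close>, \<open>D2\<close> are the matrices written
  \<open>V\<^sub>0\<^sup>2\<close>, \<open>D\<^sub>0\<^sup>2\<close>.\<close>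

definition stoch_comp :: "'a measure \<Rightarrow> ('a \<Rightarrow> real^'n \<Rightarrow> real) \<Rightarrow> 'a \<Rightarrow> real^'n \<Rightarrow> real" where
  "stoch_comp M L y \<theta> = L y \<theta> - (\<integral>y'. L y' \<theta> \<partial>M)"

definition local_set :: "real^'n^'n \<Rightarrow> real^'n \<Rightarrow> real \<Rightarrow> (real^'n) set" where
  "local_set V2 \<theta>s r = {\<theta>. norm (mat_sqrt V2 *v (\<theta> - \<theta>s)) \<le> r}"

text \<open>For the index \<open>\<epsilon> = (\<delta>, \<rho>)\<close> the lower index is \<open>-\<epsilon> = (-\<delta>, -\<rho>)\<close>, which turns the matrix
  below into \<open>(1 + \<delta>) D\<^sub>0\<^sup>2 + \<rho> V\<^sub>0\<^sup>2\<close>.\<close>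

definition D_eps2 :: "real^'n^'n \<Rightarrow> real^'n^'n \<Rightarrow> real \<Rightarrow> real \<Rightarrow> real^'n^'n" where
  "D_eps2 D2 V2 \<delta> \<rho> = (1 - \<delta>) *\<^sub>R D2 - \<rho> *\<^sub>R V2"

definition D_eps :: "real^'n^'n \<Rightarrow> real^'n^'n \<Rightarrow> real \<Rightarrow> real \<Rightarrow> real^'n^'n" where
  "D_eps D2 V2 \<delta> \<rho> = mat_sqrt (D_eps2 D2 V2 \<delta> \<rho>)"

definition xi_eps :: "(real^'n) set \<Rightarrow> ('a \<Rightarrow> real^'n \<Rightarrow> real) \<Rightarrow> real^'n \<Rightarrow>
    real^'n^'n \<Rightarrow> real^'n^'n \<Rightarrow> real \<Rightarrow> real \<Rightarrow> 'a \<Rightarrow> real^'n" where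
  "xi_eps \<Theta> L \<theta>s D2 V2 \<delta> \<rho> y = matrix_inv (D_eps D2 V2 \<delta> \<rho>) *v grad \<Theta> (L y) \<theta>s"

definition diamond_up :: "'a measure \<Rightarrow> (real^'n) set \<Rightarrow> ('a \<Rightarrow> real^'n \<Rightarrow> real) \<Rightarrow> real^'n \<Rightarrow>
    real^'n^'n \<Rightarrow> real \<Rightarrow> real \<Rightarrow> 'a \<Rightarrow> real" where
  "diamond_up M \<Theta> L \<theta>s V2 \<rho> r y =
     (SUP \<theta> \<in> local_set V2 \<theta>s r.
        (stoch_comp M L y \<theta> - stoch_comp M L y \<theta>s)
        - (\<theta> - \<theta>s) \<bullet> grad \<Theta> (stoch_comp M L y) \<theta>s
        - \<rho> / 2 * (norm (mat_sqrt V2 *v (\<theta> - \<theta>s)))\<^sup>2)"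

definition diamond_low :: "'a measure \<Rightarrow> (real^'n) set \<Rightarrow> ('a \<Rightarrow> real^'n \<Rightarrow> real) \<Rightarrow> real^'n \<Rightarrow>
    real^'n^'n \<Rightarrow> real \<Rightarrow> real \<Rightarrow> 'a \<Rightarrow> real" where
  "diamond_low M \<Theta> L \<theta>s V2 \<rho> r y =
     (SUP \<theta> \<in> local_set V2 \<theta>s r.
        - (stoch_comp M L y \<theta> - stoch_comp M L y \<theta>s)
        + (\<theta> - \<theta>s) \<bullet> grad \<Theta> (stoch_comp M L y) \<theta>s
        - \<rho> / 2 * (norm (mat_sqrt V2 *v (\<theta> - \<theta>s)))\<^sup>2)"

definition spread :: "'a measure \<Rightarrow> (real^'n) set \<Rightarrow> ('a \<Rightarrow> real^'n \<Rightarrow> real) \<Rightarrow> real^'n \<Rightarrow>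
    real^'n^'n \<Rightarrow> real^'n^'n \<Rightarrow> real \<Rightarrow> real \<Rightarrow> real \<Rightarrow> 'a \<Rightarrow> real" where
  "spread M \<Theta> L \<theta>s D2 V2 \<delta> \<rho> r y =
     diamond_up M \<Theta> L \<theta>s V2 \<rho> r y + diamond_low M \<Theta> L \<theta>s V2 \<rho> r y
     + ((norm (xi_eps \<Theta> L \<theta>s D2 V2 \<delta> \<rho> y))\<^sup>2
        - (norm (xi_eps \<Theta> L \<theta>s D2 V2 (- \<delta>) (- \<rho>) y))\<^sup>2) / 2"

definition C_event :: "'a measure \<Rightarrow> (real^'n) set \<Rightarrow> ('a \<Rightarrow> real^'n \<Rightarrow> real) \<Rightarrow> real^'n \<Rightarrow>
    ('a \<Rightarrow> real^'n) \<Rightarrow> real^'n^'n \<Rightarrow> real^'n^'n \<Rightarrow> real \<Rightarrow> real \<Rightarrow> real \<Rightarrow> 'a set" where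
  "C_event M \<Theta> L \<theta>s \<theta>t D2 V2 \<delta> \<rho> r =
     {y \<in> space M. \<theta>t y \<in> local_set V2 \<theta>s r \<and>
        norm (mat_sqrt V2 *v (matrix_inv (D_eps D2 V2 (- \<delta>) (- \<rho>))
                *v xi_eps \<Theta> L \<theta>s D2 V2 (- \<delta>) (- \<rho>) y)) \<le> r}"

text \<open>Exponential moment condition on the local set. For \<open>w = 0\<close> the quotient in the exponent is
  not defined and the condition says that the gradient of the stochastic component does not
  depend on \<open>\<theta>\<close>; as for \<open>w > 0\<close>, this is a statement about the distribution at each \<open>\<theta>\<close>, hence
  almost sure.\<close>

definition exp_moment_cond :: "'a measure \<Rightarrow> (real^'n) set \<Rightarrow> ('a \<Rightarrow> real^'n \<Rightarrow> real) \<Rightarrow> real^'n \<Rightarrow>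
    real^'n^'n \<Rightarrow> real \<Rightarrow> real \<Rightarrow> real \<Rightarrow> real \<Rightarrow> bool" where
  "exp_moment_cond M \<Theta> L \<theta>s V2 g \<nu> r w \<longleftrightarrow>
     (if w = 0
      then \<forall>\<theta> \<in> local_set V2 \<theta>s r. AE y in M.
             grad \<Theta> (stoch_comp M L y) \<theta> = grad \<Theta> (stoch_comp M L y) \<theta>s
      else \<forall>\<theta> \<in> local_set V2 \<theta>s r. \<forall>l. \<bar>l\<bar> \<le> g \<longrightarrow>
             (SUP \<gamma> \<in> UNIV - {0}. log_exp_moment M (\<lambda>y.
                l * ((\<gamma> \<bullet> (grad \<Theta> (stoch_comp M L y) \<theta> - grad \<Theta> (stoch_comp M L y) \<theta>s))
                     / (w * norm (mat_sqrt V2 *v \<gamma>)))))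
             \<le> ereal (\<nu>\<^sup>2 * l\<^sup>2 / 2))"

end

theory Submission
  imports Defs
begin

text \<open>
  The inequality of probabilities comes from an inclusion of events: at every observation in the
  event on the left, \<open>\<parallel>D\<^sub>\<epsilon> (\<theta>t - \<theta>s)\<parallel> \<le> \<parallel>\<xi>\<^sub>\<epsilon>\<parallel> + sqrt (2 \<Delta>\<^sub>\<epsilon>)\<close>. On the local set the expected
  log-likelihood ratio lies between two multiples of \<open>- \<parallel>D\<^sub>0 u\<parallel>\<^sup>2 / 2\<close>, where \<open>u = \<theta> - \<theta>s\<close>, and the two
  suprema bound the error of linearizing the stochastic component, up to \<open>\<rho> \<parallel>V\<^sub>0 u\<parallel>\<^sup>2 / 2\<close>. With
  \<open>G = \<nabla>L(\<theta>s)\<close>, the sum of the two bounds brackets the log-likelihood ratio \<open>l u\<close> between quadratic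
  functions: it is at most \<open>u \<bullet> G - \<parallel>D\<^sub>\<epsilon> u\<parallel>\<^sup>2 / 2\<close> plus the upper supremum, and at least the same
  expression for the index \<open>- \<epsilon>\<close> minus the lower supremum. The lower quadratic function is maximal at
  \<open>w = D\<^sub>-\<^sub>\<epsilon>\<^sup>-\<^sup>1 \<xi>\<^sub>-\<^sub>\<epsilon>\<close>, with value \<open>\<parallel>\<xi>\<^sub>-\<^sub>\<epsilon>\<parallel>\<^sup>2 / 2\<close>, and the event \<open>C\<^sub>\<epsilon>\<close> says exactly that both
  \<open>\<theta>s + w\<close> and \<open>\<theta>t\<close> are in the local set. As \<open>\<theta>t\<close> is a maximizer, \<open>l w \<le> l (\<theta>t - \<theta>s)\<close>; completing the
  square in the upper quadratic function turns this into
  \<open>\<parallel>D\<^sub>\<epsilon> (\<theta>t - \<theta>s) - \<xi>\<^sub>\<epsilon>\<parallel>\<^sup>2 \<le> 2 \<Delta>\<^sub>\<epsilon>\<close> (\<open>bracketed_maximizer_bound\<close>), and the triangle inequality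
  finishes the argument.

  Two points need more than this. The matrix roots are definite descriptions, so the existence and
  uniqueness of a symmetric positive-definite root must be shown; both follow from an orthonormal
  eigenbasis (\<open>symmetric_orthonormal_eigenbasis\<close>). And the measure of a set that is not measurable is
  zero, so that the inclusion only gives the inequality once the event on the right is known to be
  measurable. The gradient at the interior point \<open>\<theta>s\<close> is a limit of difference quotients
  (\<open>borel_measurable_grad\<close>), and the suprema are countable ones because the functions are continuous
  on the compact local set (\<open>borel_measurable_SUP_compact\<close>).
\<close>

section \<open>Eigenbases of symmetric matrices\<close>

lemma quadratic_nonneg_imp_linear_zero:
  fixes a c :: real
  assumes "\<And>t. 0 \<le> t * a + t\<^sup>2 * c"
  shows "a = 0"
proof (rule ccontr)
  assume "a \<noteq> 0"
  \<comment> \<open>For \<open>k > 0\<close> the quadratic takes the value \<open>a\<^sup>2 (c - k) / k\<^sup>2\<close> at \<open>- a / k\<close>, negative once \<open>k > c\<close>.\<close>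
  define k where "k = \<bar>c\<bar> + 1"
  have k: "k > 0" "c < k" by (auto simp: k_def)
  have "0 \<le> (- a / k) * a + (- a / k)\<^sup>2 * c" by (rule assms)
  also have "\<dots> = a\<^sup>2 * (c - k) / k\<^sup>2"
    using k by (simp add: field_simps power2_eq_square)
  also have "\<dots> < 0"
    using k \<open>a \<noteq> 0\<close> by (simp add: divide_neg_pos mult_pos_neg)
  finally show False by simp
qed

lemma symmetric_inner_swap:
  fixes A :: "real^'n^'n"
  assumes "transpose A = A"
  shows "x \<bullet> (A *v y) = (A *v x) \<bullet> y"
  by (metis assms dot_lmul_matrix transpose_matrix_vector)

text \<open>The orthogonal complement of a set of eigenvectors is an invariant subspace. A maximizer of the
  quadratic form \<open>s \<bullet> A s\<close> on its unit sphere is an eigenvector: with \<open>\<mu>\<close> the maximum, the form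
  \<open>\<mu> (s \<bullet> s) - s \<bullet> A s\<close> is nonnegative and vanishes at the maximizer, so that its first variation
  vanishes there.\<close>

lemma symmetric_eigenvector_orthogonal:
  fixes A :: "real^'n^'n"
  assumes sym: "transpose A = A"
    and eig: "\<And>b. b \<in> B \<Longrightarrow> \<exists>\<mu>. A *v b = \<mu> *\<^sub>R b"
    and "x \<noteq> 0" and x: "\<And>b. b \<in> B \<Longrightarrow> x \<bullet> b = 0"
  obtains v \<mu> where "norm v = 1" "\<And>b. b \<in> B \<Longrightarrow> v \<bullet> b = 0" "A *v v = \<mu> *\<^sub>R v"
proof -
  define S where "S = {x. \<forall>b\<in>B. x \<bullet> b = 0}"
  have S: "subspace S"
    unfolding S_def by (auto simp: subspace_def inner_left_distrib)
  have AS: "A *v s \<in> S" if "s \<in> S" for s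
    unfolding S_def mem_Collect_eq
  proof
    fix b assume b: "b \<in> B"
    then obtain \<mu> where "A *v b = \<mu> *\<^sub>R b" using eig by blast
    then have "(A *v s) \<bullet> b = \<mu> * (s \<bullet> b)"
      by (simp add: symmetric_inner_swap[OF sym, symmetric])
    then show "(A *v s) \<bullet> b = 0" using that b by (simp add: S_def)
  qed
  have cpt: "compact (S \<inter> sphere 0 1)"
    by (intro closed_Int_compact closed_subspace S) auto
  have "x /\<^sub>R norm x \<in> S \<inter> sphere 0 1"
    using \<open>x \<noteq> 0\<close> x by (auto simp: S_def)
  then have ne: "S \<inter> sphere 0 1 \<noteq> {}" by blast
  have cont: "continuous_on (S \<inter> sphere 0 1) (\<lambda>s. s \<bullet> (A *v s))"
    by (intro continuous_on_inner continuous_on_id matrix_vector_mult_linear_continuous_on)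
  obtain v where v: "v \<in> S \<inter> sphere 0 1"
    and max: "\<And>s. s \<in> S \<inter> sphere 0 1 \<Longrightarrow> s \<bullet> (A *v s) \<le> v \<bullet> (A *v v)"
    using continuous_attains_sup[OF cpt ne cont] by blast
  define \<mu> where "\<mu> = v \<bullet> (A *v v)"
  have nv: "v \<bullet> v = 1" and vS: "v \<in> S"
    using v by (auto simp: dot_square_norm)
  have nonneg: "0 \<le> \<mu> * (s \<bullet> s) - s \<bullet> (A *v s)" if "s \<in> S" for s
  proof (cases "s = 0")
    case False
    have "s /\<^sub>R norm s \<in> S \<inter> sphere 0 1"
      using that False subspace_scale[OF S] by auto
    from max[OF this] False show ?thesis
      by (simp add: \<mu>_def[symmetric] matrix_vector_mult_scaleR dot_square_norm field_simps power2_eq_square)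
  qed simp
  \<comment> \<open>The residual \<open>h\<close> lies in \<open>S\<close>, and the first variation in its own direction is \<open>2 (h \<bullet> h)\<close>.\<close>
  define h where "h = \<mu> *\<^sub>R v - A *v v"
  have hS: "h \<in> S"
    unfolding h_def by (intro subspace_diff S subspace_scale vS AS)
  have "0 \<le> t * (2 * (h \<bullet> h)) + t\<^sup>2 * (\<mu> * (h \<bullet> h) - h \<bullet> (A *v h))" for t
  proof -
    have sw: "v \<bullet> (A *v h) = h \<bullet> (A *v v)"
      using symmetric_inner_swap[OF sym, of v h] by (simp add: inner_commute)
    have hh: "h \<bullet> h = \<mu> * (h \<bullet> v) - h \<bullet> (A *v v)"
      by (subst (2) h_def) (simp add: inner_diff_right)
    have "0 \<le> \<mu> * ((v + t *\<^sub>R h) \<bullet> (v + t *\<^sub>R h)) - (v + t *\<^sub>R h) \<bullet> (A *v (v + t *\<^sub>R h))"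
      by (intro nonneg subspace_add S subspace_scale vS hS)
    also have "\<dots> = t * (2 * (h \<bullet> h)) + t\<^sup>2 * (\<mu> * (h \<bullet> h) - h \<bullet> (A *v h))"
      unfolding hh matrix_vector_right_distrib matrix_vector_mult_scaleR inner_add_left inner_add_right
        inner_scaleR_left inner_scaleR_right sw nv \<mu>_def[symmetric] inner_commute[of v h]
      by (simp add: algebra_simps power2_eq_square)
    finally show ?thesis .
  qed
  then have "2 * (h \<bullet> h) = 0" by (rule quadratic_nonneg_imp_linear_zero)
  then have "A *v v = \<mu> *\<^sub>R v" by (simp add: h_def)
  with v show thesis by (intro that[of v \<mu>]) (auto simp: S_def)
qed

text \<open>An orthonormal set of eigenvectors of the largest possible size spans the space, since
  otherwise another eigenvector could be added to it.\<close>

lemma symmetric_orthonormal_eigenbasis: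
  fixes A :: "real^'n^'n"
  assumes sym: "transpose A = A"
  obtains B where "finite B" "pairwise orthogonal B" "\<And>b. b \<in> B \<Longrightarrow> norm b = 1"
    "\<And>b. b \<in> B \<Longrightarrow> \<exists>\<mu>. A *v b = \<mu> *\<^sub>R b" "span B = UNIV"
proof -
  define P where "P B \<longleftrightarrow> pairwise orthogonal B \<and> (\<forall>b\<in>B. norm b = 1 \<and> (\<exists>\<mu>. A *v b = \<mu> *\<^sub>R b))"
    for B :: "(real^'n) set"
  have indep: "independent B" if "P B" for B
    using that by (intro pairwise_orthogonal_independent) (auto simp: P_def)
  have card: "card B < Suc DIM(real^'n)" if "P B" for B
    using independent_bound[OF indep[OF that]] by simp
  have "P {}" by (simp add: P_def)
  then obtain B where B: "P B" and max: "\<And>C. P C \<Longrightarrow> card C \<le> card B"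
    using ex_has_greatest_nat[of P "{}" card "Suc DIM(real^'n)"] card by (auto simp: less_imp_le)
  have fin: "finite B" using independent_bound[OF indep[OF B]] by simp
  have "span B = UNIV"
  proof (rule ccontr)
    assume "span B \<noteq> UNIV"
    then have "span B \<subset> span UNIV" by auto
    then obtain x where "x \<noteq> 0" and x: "\<And>y. y \<in> span B \<Longrightarrow> orthogonal x y"
      using orthogonal_to_subspace_exists_gen by metis
    have x0: "x \<bullet> b = 0" if "b \<in> B" for b
      using x[OF span_base[OF that]] by (simp add: orthogonal_def)
    have eig: "\<exists>\<mu>. A *v b = \<mu> *\<^sub>R b" if "b \<in> B" for b
      using B that by (simp add: P_def)
    obtain v \<mu> where v: "norm v = 1" "\<And>b. b \<in> B \<Longrightarrow> v \<bullet> b = 0" "A *v v = \<mu> *\<^sub>R v"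
      using symmetric_eigenvector_orthogonal[OF sym eig \<open>x \<noteq> 0\<close> x0] by blast
    have "v \<notin> B" using v(1) v(2)[of v] by (auto simp: dot_square_norm)
    moreover have "P (insert v B)"
      using B v unfolding P_def pairwise_insert orthogonal_def by (auto simp: inner_commute)
    ultimately show False using max[of "insert v B"] fin by simp
  qed
  with B fin show thesis by (intro that[of B]) (auto simp: P_def)
qed

section \<open>The positive-definite root\<close>

lemma sym_pos_def_mult_eq_0:
  assumes "sym_pos_def A" "A *v x = 0"
  shows "x = 0"
  using assms unfolding sym_pos_def_def by (metis inner_zero_right less_irrefl)

text \<open>The root multiplies each vector of an orthonormal eigenbasis by the square root of its
  eigenvalue.\<close>

lemma sym_pos_def_sqrt_exists:
  fixes A :: "real^'n^'n"
  assumes A: "sym_pos_def A"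
  shows "\<exists>R. sym_pos_def R \<and> R ** R = A"
proof -
  have sym: "transpose A = A" and pos: "\<And>x. x \<noteq> 0 \<Longrightarrow> 0 < x \<bullet> (A *v x)"
    using A by (auto simp: sym_pos_def_def)
  obtain B where fin: "finite B" and orth: "pairwise orthogonal B" and n1: "\<And>b. b \<in> B \<Longrightarrow> norm b = 1"
    and eig: "\<And>b. b \<in> B \<Longrightarrow> \<exists>\<mu>. A *v b = \<mu> *\<^sub>R b" and span: "span B = UNIV"
    using symmetric_orthonormal_eigenbasis[OF sym] by metis
  define \<mu> where "\<mu> b = b \<bullet> (A *v b)" for b
  have \<mu>pos: "\<mu> b > 0" if "b \<in> B" for b
    using pos[of b] n1[OF that] by (cases "b = 0") (auto simp: \<mu>_def)
  have \<mu>eig: "A *v b = \<mu> b *\<^sub>R b" if "b \<in> B" for b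
    using eig[OF that] n1[OF that] by (auto simp: \<mu>_def dot_square_norm)
  define f where "f x = (\<Sum>b\<in>B. (sqrt (\<mu> b) * (b \<bullet> x)) *\<^sub>R b)" for x
  have lin: "linear f"
    unfolding f_def
    by (intro linearI)
      (simp_all add: inner_add_right distrib_left scaleR_add_left sum.distrib scaleR_sum_right mult_ac)
  define R where "R = matrix f"
  have R: "R *v x = f x" for x
    using lin by (simp add: R_def)
  have fb: "f b = sqrt (\<mu> b) *\<^sub>R b" if "b \<in> B" for b
  proof -
    have "f b = (\<Sum>c\<in>B. if c = b then sqrt (\<mu> b) *\<^sub>R b else 0)"
      unfolding f_def using orth n1[OF that] that
      by (intro sum.cong) (auto simp: pairwise_def orthogonal_def dot_square_norm)
    then show ?thesis using fin that by simp
  qed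
  have swap: "x \<bullet> f y = f x \<bullet> y" for x y
    unfolding f_def by (simp add: inner_sum_left inner_sum_right mult_ac inner_commute)
  have "transpose R = R"
    by (metis R swap matrix_eq dot_lmul_matrix transpose_matrix_vector vector_eq_rdot)
  moreover have "0 < x \<bullet> (R *v x)" if "x \<noteq> 0" for x
  proof -
    have eq: "x \<bullet> (R *v x) = (\<Sum>b\<in>B. sqrt (\<mu> b) * (b \<bullet> x)\<^sup>2)"
      unfolding R f_def by (simp add: inner_sum_right power2_eq_square inner_commute mult_ac)
    have "\<exists>b\<in>B. b \<bullet> x \<noteq> 0"
    proof (rule ccontr)
      assume "\<not> ?thesis"
      then have "orthogonal x x"
        using span by (intro orthogonal_to_span[of x B x]) (auto simp: orthogonal_def inner_commute)
      with that show False by (simp add: orthogonal_def)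
    qed
    then obtain b where "b \<in> B" "b \<bullet> x \<noteq> 0" by blast
    then show ?thesis unfolding eq using fin \<mu>pos
      by (intro sum_pos2[of B b]) (auto simp: less_imp_le)
  qed
  moreover have "R ** R = A"
  proof -
    have "(R ** R) *v x = A *v x" for x
    proof (rule linear_eq_on_span[where f = "(*v) (R ** R)" and g = "(*v) A" and B = B])
      show "(R ** R) *v b = A *v b" if "b \<in> B" for b
        using that \<mu>pos[OF that] lin
        by (simp add: matrix_vector_mul_assoc[symmetric] R fb linear_scale \<mu>eig)
    qed (use span in auto)
    then show ?thesis by (simp add: matrix_eq)
  qed
  ultimately show ?thesis by (auto simp: sym_pos_def_def)
qed

text \<open>If \<open>R b = \<mu> b\<close>, then \<open>(R' + \<mu>) (R' b - \<mu> b) = R'\<^sup>2 b - \<mu>\<^sup>2 b = 0\<close>, and \<open>R' + \<mu>\<close> is injective because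
  \<open>R'\<close> is positive definite and \<open>\<mu> > 0\<close>. So \<open>R'\<close> agrees with \<open>R\<close> on an eigenbasis of \<open>R\<close>.\<close>

lemma sym_pos_def_sqrt_unique:
  fixes R R' :: "real^'n^'n"
  assumes R: "sym_pos_def R" and R': "sym_pos_def R'" and eq: "R ** R = R' ** R'"
  shows "R = R'"
proof -
  obtain B where n1: "\<And>b. b \<in> B \<Longrightarrow> norm b = 1"
    and eig: "\<And>b. b \<in> B \<Longrightarrow> \<exists>\<mu>. R *v b = \<mu> *\<^sub>R b" and span: "span B = UNIV"
    using symmetric_orthonormal_eigenbasis[of R] R unfolding sym_pos_def_def by metis
  have "R *v x = R' *v x" for x
  proof (rule linear_eq_on_span[where f = "(*v) R" and g = "(*v) R'" and B = B])
    fix b assume b: "b \<in> B"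
    from eig[OF b] obtain \<mu> where \<mu>: "R *v b = \<mu> *\<^sub>R b" by blast
    have "0 < b \<bullet> (R *v b)" using R n1[OF b] by (cases "b = 0") (auto simp: sym_pos_def_def)
    then have \<mu>pos: "\<mu> > 0" using n1[OF b] by (simp add: \<mu> dot_square_norm)
    define d where "d = R' *v b - \<mu> *\<^sub>R b"
    have "R' *v (R' *v b) = R *v (R *v b)" by (simp add: matrix_vector_mul_assoc eq)
    also have "\<dots> = (\<mu> * \<mu>) *\<^sub>R b" by (simp add: \<mu> matrix_vector_mult_scaleR)
    finally have "R' *v d = - \<mu> *\<^sub>R d"
      by (simp add: d_def matrix_vector_mult_diff_distrib matrix_vector_mult_scaleR algebra_simps)
    then have "d \<bullet> (R' *v d) \<le> 0" using \<mu>pos by simp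
    then have "d = 0" using R' unfolding sym_pos_def_def by (meson not_le)
    then show "R *v b = R' *v b" by (simp add: \<mu> d_def)
  qed (use span in auto)
  then show ?thesis by (simp add: matrix_eq)
qed

lemma mat_sqrt_props:
  fixes A :: "real^'n^'n"
  assumes "sym_pos_def A"
  shows sym_pos_def_mat_sqrt: "sym_pos_def (mat_sqrt A)"
    and mat_sqrt_square: "mat_sqrt A ** mat_sqrt A = A"
proof -
  have "\<exists>!R. sym_pos_def R \<and> R ** R = A"
    using sym_pos_def_sqrt_exists[OF assms] sym_pos_def_sqrt_unique by blast
  from theI'[OF this] show "sym_pos_def (mat_sqrt A)" "mat_sqrt A ** mat_sqrt A = A"
    by (auto simp: mat_sqrt_def)
qed

lemma norm_mat_sqrt_square:
  fixes A :: "real^'n^'n"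
  assumes "sym_pos_def A"
  shows "(norm (mat_sqrt A *v u))\<^sup>2 = u \<bullet> (A *v u)"
proof -
  have "transpose (mat_sqrt A) = mat_sqrt A"
    using sym_pos_def_mat_sqrt[OF assms] by (simp add: sym_pos_def_def)
  from symmetric_inner_swap[OF this, of u "mat_sqrt A *v u"] show ?thesis
    by (simp add: dot_square_norm matrix_vector_mul_assoc mat_sqrt_square[OF assms])
qed

lemma sym_pos_def_inverse:
  fixes A :: "real^'n^'n"
  assumes "sym_pos_def A"
  shows sym_pos_def_inverse_right: "A *v (matrix_inv A *v x) = x"
    and sym_pos_def_inverse_left: "matrix_inv A *v (A *v x) = x"
proof -
  have "invertible A"
    unfolding invertible_left_inverse matrix_left_invertible_ker
    using sym_pos_def_mult_eq_0[OF assms] by blast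
  then have "A ** matrix_inv A = mat 1 \<and> matrix_inv A ** A = mat 1"
    unfolding invertible_def matrix_inv_def by (rule someI_ex)
  then show "A *v (matrix_inv A *v x) = x" "matrix_inv A *v (A *v x) = x"
    by (simp_all add: matrix_vector_mul_assoc)
qed

section \<open>The local ellipsoid and gradients at interior points\<close>

lemma compact_local_set:
  assumes "sym_pos_def V2"
  shows "compact (local_set V2 \<theta>s r)"
proof -
  let ?V = "mat_sqrt V2"
  note V = sym_pos_def_mat_sqrt[OF assms]
  have "local_set V2 \<theta>s r = (\<lambda>x. \<theta>s + matrix_inv ?V *v x) ` cball 0 r"
  proof (intro equalityI subsetI)
    fix \<theta> assume "\<theta> \<in> local_set V2 \<theta>s r"
    then show "\<theta> \<in> (\<lambda>x. \<theta>s + matrix_inv ?V *v x) ` cball 0 r"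
      by (intro image_eqI[of _ _ "?V *v (\<theta> - \<theta>s)"])
        (auto simp: local_set_def sym_pos_def_inverse_left[OF V])
  qed (auto simp: local_set_def sym_pos_def_inverse_right[OF V])
  moreover have "compact ((\<lambda>x. \<theta>s + matrix_inv ?V *v x) ` cball 0 r)"
    by (intro compact_continuous_image continuous_on_add continuous_on_const
        matrix_vector_mult_linear_continuous_on compact_cball)
  ultimately show ?thesis by simp
qed

lemma continuous_on_norm_matrix_vector_mult:
  fixes A :: "real^'n^'m"
  shows "continuous_on S (\<lambda>x. norm (A *v (x - c)))"
  by (intro continuous_on_norm continuous_intros subset_UNIV
      continuous_on_compose2[OF matrix_vector_mult_linear_continuous_on[of UNIV]])

lemma center_in_interior_local_set:
  assumes "0 < r"
  shows "\<theta>s \<in> interior (local_set V2 \<theta>s r)"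
proof (rule interiorI)
  show "open {\<theta>. norm (mat_sqrt V2 *v (\<theta> - \<theta>s)) < r}"
    by (intro open_Collect_less continuous_on_norm_matrix_vector_mult continuous_on_const)
qed (use assms in \<open>auto simp: local_set_def\<close>)

text \<open>At interior points the derivative within the set is the ordinary one, so that the relative
  gradient obeys the rules for gradients of functions on the whole space. The parameter \<open>\<theta>s\<close> is such
  a point.\<close>

lemma GDERIV_grad:
  fixes f :: "real^'n \<Rightarrow> real"
  assumes "x \<in> interior S" "f differentiable (at x within S)"
  shows "GDERIV f x :> grad S f x"
proof -
  have at: "at x within S = at x" using assms(1) by (rule at_within_interior)
  define F where "F = frechet_derivative f (at x)"
  have F: "(f has_derivative F) (at x)"
    using assms(2) unfolding at F_def frechet_derivative_works .
  have lin: "linear F" using F by (rule has_derivative_linear)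
  have "F h = h \<bullet> grad S f x" for h
  proof -
    have "F h = F (\<Sum>i\<in>UNIV. h $ i *\<^sub>R axis i 1)"
      by (simp add: basis_expansion scalar_mult_eq_scaleR[symmetric])
    also have "\<dots> = (\<Sum>i\<in>UNIV. h $ i * F (axis i 1))"
      by (simp add: linear_sum[OF lin] linear_scale[OF lin])
    also have "\<dots> = h \<bullet> grad S f x"
      by (simp add: inner_vec_def grad_def at F_def)
    finally show ?thesis .
  qed
  then have "F = (\<lambda>h. h \<bullet> grad S f x)" by (rule ext)
  then show ?thesis unfolding gderiv_def by (rule has_derivative_eq_rhs[OF F])
qed

lemma grad_eqI:
  fixes f :: "real^'n \<Rightarrow> real"
  assumes "x \<in> interior S" "GDERIV f x :> G"
  shows "grad S f x = G"
proof -
  have "frechet_derivative f (at x within S) = (\<lambda>h. h \<bullet> G)"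
    unfolding at_within_interior[OF assms(1)]
    by (rule frechet_derivative_at[symmetric]) (use assms(2) in \<open>simp only: gderiv_def\<close>)
  then have "grad S f x = (\<chi> i. axis i 1 \<bullet> G)"
    by (simp only: grad_def)
  also have "\<dots> = G" by (simp add: vec_eq_iff inner_axis')
  finally show ?thesis .
qed

section \<open>Measurability of gradients and suprema\<close>

text \<open>The step lengths of the difference quotients are chosen so that all points stay in a ball inside
  \<open>S\<close>, where the function is known to be measurable in \<open>y\<close>.\<close>

lemma borel_measurable_grad:
  fixes f :: "'a \<Rightarrow> real^'n \<Rightarrow> real"
  assumes x: "x \<in> interior S"
    and meas: "\<And>s. s \<in> S \<Longrightarrow> (\<lambda>y. f y s) \<in> borel_measurable M"
    and diff: "\<And>y. y \<in> space M \<Longrightarrow> f y differentiable (at x within S)"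
  shows "(\<lambda>y. grad S (f y) x) \<in> borel_measurable M"
proof (subst borel_measurable_euclidean_space, rule ballI)
  fix h :: "real^'n" assume h: "h \<in> Basis"
  obtain e where e: "e > 0" "cball x e \<subseteq> S"
    using x unfolding mem_interior_cball by auto
  define t where "t n = e / real (Suc n)" for n
  have t0: "t \<longlonglongrightarrow> 0"
    unfolding t_def by (rule LIMSEQ_Suc[OF lim_const_over_n])
  have tpos: "t n > 0" for n using e by (simp add: t_def)
  have tin: "x + t n *\<^sub>R h \<in> S" for n
  proof -
    have "t n \<le> e" using e by (simp add: t_def field_simps)
    then have "x + t n *\<^sub>R h \<in> cball x e"
      using h tpos[of n] by (simp add: dist_norm)
    then show ?thesis using e by blast
  qed
  have "x \<in> S" using x interior_subset by blast
  show "(\<lambda>y. grad S (f y) x \<bullet> h) \<in> borel_measurable M"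
  proof (rule borel_measurable_LIMSEQ_real)
    show "(\<lambda>y. (f y (x + t n *\<^sub>R h) - f y x) / t n) \<in> borel_measurable M" for n
      using meas[OF tin] meas[OF \<open>x \<in> S\<close>] by measurable
  next
    fix y assume "y \<in> space M"
    have "(f y has_derivative (\<lambda>h. h \<bullet> grad S (f y) x)) (at (x + 0 *\<^sub>R h))"
      using GDERIV_grad[OF x diff[OF \<open>y \<in> space M\<close>]] by (simp add: gderiv_def)
    then have "((\<lambda>s. f y (x + s *\<^sub>R h)) has_derivative (\<lambda>s. (s *\<^sub>R h) \<bullet> grad S (f y) x)) (at 0)"
      by (rule has_derivative_compose[rotated]) (auto intro!: derivative_eq_intros)
    then have "((\<lambda>s. f y (x + s *\<^sub>R h)) has_field_derivative (grad S (f y) x \<bullet> h)) (at 0)"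
      unfolding has_field_derivative_def
      by (rule has_derivative_eq_rhs) (simp add: fun_eq_iff inner_commute)
    then have "((\<lambda>s. (f y (x + s *\<^sub>R h) - f y x) / s) \<longlongrightarrow> grad S (f y) x \<bullet> h) (at 0)"
      by (simp add: has_field_derivative_iff)
    moreover have "filterlim t (at 0) sequentially"
      using t0 tpos by (simp add: filterlim_at less_imp_neq[THEN not_sym])
    ultimately show "(\<lambda>n. (f y (x + t n *\<^sub>R h) - f y x) / t n) \<longlonglongrightarrow> grad S (f y) x \<bullet> h"
      by (rule filterlim_compose)
  qed
qed

text \<open>By continuity the supremum over a countable dense subset is the same; compactness makes it
  finite.\<close>

lemma borel_measurable_SUP_compact:
  fixes f :: "'a \<Rightarrow> 'b::{metric_space, second_countable_topology} \<Rightarrow> real"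
  assumes K: "compact K"
    and meas: "\<And>x. x \<in> K \<Longrightarrow> (\<lambda>y. f y x) \<in> borel_measurable M"
    and cont: "\<And>y. y \<in> space M \<Longrightarrow> continuous_on K (f y)"
  shows "(\<lambda>y. SUP x\<in>K. f y x) \<in> borel_measurable M"
proof (cases "K = {}")
  case False
  obtain T where T: "countable T" "T \<subseteq> K" "K \<subseteq> closure T"
    using separable by blast
  have cl: "closure T = K"
    using T K by (metis closure_minimal compact_imp_closed subset_antisym)
  have "T \<noteq> {}" using cl False by auto
  have bdd: "bdd_above (f y ` K)" if "y \<in> space M" for y
    using compact_continuous_image[OF cont[OF that] K]
    by (intro bounded_imp_bdd_above compact_imp_bounded)
  have bddT: "bdd_above (f y ` T)" if "y \<in> space M" for y
    using bdd[OF that] by (rule bdd_above_mono) (use T in auto)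
  have "(SUP x\<in>K. f y x) = (SUP x\<in>T. f y x)" if y: "y \<in> space M" for y
  proof (rule antisym)
    show "(SUP x\<in>K. f y x) \<le> (SUP x\<in>T. f y x)"
    proof (rule cSUP_least[OF False])
      fix x assume "x \<in> K"
      show "f y x \<le> (SUP x\<in>T. f y x)"
        by (rule continuous_le_on_closure[of T "f y" x])
          (use cl cont[OF y] \<open>x \<in> K\<close> cSUP_upper[OF _ bddT[OF y]] in auto)
    qed
    show "(SUP x\<in>T. f y x) \<le> (SUP x\<in>K. f y x)"
      by (rule cSUP_subset_mono[OF \<open>T \<noteq> {}\<close> bdd[OF y] T(2)]) simp
  qed
  moreover have "(\<lambda>y. SUP x\<in>T. f y x) \<in> borel_measurable M"
    using T meas bddT by (intro borel_measurable_cSUP) auto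
  ultimately show ?thesis by (simp cong: measurable_cong)
qed simp

section \<open>Quadratic bracketing\<close>

lemma le_SUP_compact:
  fixes f :: "'b::topological_space \<Rightarrow> real"
  assumes "compact K" "continuous_on K f" "x \<in> K"
  shows "f x \<le> (SUP x\<in>K. f x)"
  using assms
  by (intro cSUP_upper bounded_imp_bdd_above compact_imp_bounded compact_continuous_image)

text \<open>The deterministic core. With \<open>R\<close> and \<open>R'\<close> the roots of \<open>A\<close> and \<open>A'\<close>, the upper quadratic function
  at \<open>u\<close> equals \<open>\<parallel>\<xi>\<parallel>\<^sup>2 / 2 - \<parallel>R u - \<xi>\<parallel>\<^sup>2 / 2\<close>, and the lower one at its maximizer \<open>w\<close> equals
  \<open>\<parallel>\<xi>'\<parallel>\<^sup>2 / 2\<close>. Comparing the two through \<open>l w \<le> l u\<close> bounds \<open>\<parallel>R u - \<xi>\<parallel>\<close>.\<close>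

lemma bracketed_maximizer_bound:
  fixes A A' :: "real^'n^'n" and l :: "real^'n \<Rightarrow> real" and G :: "real^'n"
  assumes A: "sym_pos_def A" and A': "sym_pos_def A'"
  defines "\<xi> \<equiv> matrix_inv (mat_sqrt A) *v G"
    and "\<xi>' \<equiv> matrix_inv (mat_sqrt A') *v G"
  defines "w \<equiv> matrix_inv (mat_sqrt A') *v \<xi>'"
  assumes up: "l u \<le> u \<bullet> G - u \<bullet> (A *v u) / 2 + a"
    and low: "w \<bullet> G - w \<bullet> (A' *v w) / 2 - b \<le> l w"
    and max: "l w \<le> l u"
  shows "norm (mat_sqrt A *v u) \<le> norm \<xi> + sqrt (2 * (a + b + ((norm \<xi>)\<^sup>2 - (norm \<xi>')\<^sup>2) / 2))"
proof -
  note R = sym_pos_def_mat_sqrt[OF A] and R' = sym_pos_def_mat_sqrt[OF A']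
  have inner: "v \<bullet> G = (mat_sqrt B *v v) \<bullet> (matrix_inv (mat_sqrt B) *v G)"
    if "sym_pos_def B" for v and B :: "real^'n^'n"
  proof -
    have "transpose (mat_sqrt B) = mat_sqrt B"
      using sym_pos_def_mat_sqrt[OF that] by (simp add: sym_pos_def_def)
    then show ?thesis
      by (simp add: symmetric_inner_swap[symmetric] sym_pos_def_inverse_right[OF sym_pos_def_mat_sqrt[OF that]])
  qed
  have w: "mat_sqrt A' *v w = \<xi>'"
    by (simp add: w_def sym_pos_def_inverse_right[OF R'])
  have "w \<bullet> G - w \<bullet> (A' *v w) / 2 = (norm \<xi>')\<^sup>2 / 2"
    unfolding norm_mat_sqrt_square[OF A', symmetric] inner[OF A'] w
    by (simp add: \<xi>'_def[symmetric] dot_square_norm)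
  moreover have "u \<bullet> G - u \<bullet> (A *v u) / 2
      = (norm \<xi>)\<^sup>2 / 2 - (norm (mat_sqrt A *v u - \<xi>))\<^sup>2 / 2"
    unfolding norm_mat_sqrt_square[OF A, symmetric] inner[OF A] \<xi>_def[symmetric]
    by (simp add: power2_norm_eq_inner inner_diff_left inner_diff_right inner_commute field_simps)
  ultimately have "(norm (mat_sqrt A *v u - \<xi>))\<^sup>2
      \<le> 2 * (a + b + ((norm \<xi>)\<^sup>2 - (norm \<xi>')\<^sup>2) / 2)"
    using up low max by (simp add: field_simps)
  then have "norm (mat_sqrt A *v u - \<xi>) \<le> sqrt (2 * (a + b + ((norm \<xi>)\<^sup>2 - (norm \<xi>')\<^sup>2) / 2))"
    by (rule real_le_rsqrt)
  then show ?thesis using norm_triangle_sub[of "mat_sqrt A *v u" \<xi>] by linarith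
qed

lemma D_eps2_quadratic_form:
  "u \<bullet> (D_eps2 D2 V2 \<delta> \<rho> *v u) = (1 - \<delta>) * (u \<bullet> (D2 *v u)) - \<rho> * (u \<bullet> (V2 *v u))"
  by (simp add: D_eps2_def matrix_vector_mult_diff_rdistrib scaleR_matrix_vector_assoc[symmetric]
      inner_diff_right)

lemma sym_pos_def_D_eps2_lower:
  assumes "sym_pos_def D2" "sym_pos_def V2" "0 \<le> \<delta>" "0 \<le> \<rho>"
  shows "sym_pos_def (D_eps2 D2 V2 (- \<delta>) (- \<rho>))"
proof -
  have "transpose (D_eps2 D2 V2 (- \<delta>) (- \<rho>)) = D_eps2 D2 V2 (- \<delta>) (- \<rho>)"
    using assms(1,2) by (auto simp: sym_pos_def_def D_eps2_def transpose_def vec_eq_iff)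
  moreover have "0 < u \<bullet> (D_eps2 D2 V2 (- \<delta>) (- \<rho>) *v u)" if "u \<noteq> 0" for u
  proof -
    have "0 < u \<bullet> (D2 *v u)" "0 < u \<bullet> (V2 *v u)"
      using assms(1,2) that by (auto simp: sym_pos_def_def)
    then show ?thesis using assms(3,4)
      unfolding D_eps2_quadratic_form by (simp add: add_pos_nonneg)
  qed
  ultimately show ?thesis by (simp add: sym_pos_def_def)
qed

lemma quadratic_ratio_bounds:
  fixes e q \<delta>r \<delta> :: real
  assumes "q > 0" "\<bar>(- 2 * e) / q - 1\<bar> \<le> \<delta>r" "\<delta>r \<le> \<delta>"
  shows "- ((1 + \<delta>) * q / 2) \<le> e" "e \<le> - ((1 - \<delta>) * q / 2)"
proof -
  have "\<bar>(- 2 * e) / q - 1\<bar> \<le> \<delta>" using assms by linarith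
  then have "(- 2 * e) / q \<le> 1 + \<delta>" "1 - \<delta> \<le> (- 2 * e) / q" by linarith+
  then have "- 2 * e \<le> (1 + \<delta>) * q" "(1 - \<delta>) * q \<le> - 2 * e"
    using \<open>q > 0\<close> by (simp_all only: pos_divide_le_eq pos_le_divide_eq)
  then show "- ((1 + \<delta>) * q / 2) \<le> e" "e \<le> - ((1 - \<delta>) * q / 2)" by linarith+
qed

theorem corollary3p5:
  fixes M :: "'a measure"
    and \<Theta> :: "(real^'n) set"
    and L :: "'a \<Rightarrow> real^'n \<Rightarrow> real"
    and \<theta>t :: "'a \<Rightarrow> real^'n"
    and \<theta>s :: "real^'n"
    and V2 D2 :: "real^'n^'n"
    and g \<nu>0 r0 r \<omega>r \<delta>r \<delta> \<rho> z :: real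
  assumes "prob_space M"
    and "\<And>\<theta>. \<theta> \<in> \<Theta> \<Longrightarrow> integrable M (\<lambda>y. L y \<theta>)"
    and "\<theta>t \<in> borel_measurable M"
    and "\<And>y. y \<in> space M \<Longrightarrow> is_arg_max (L y) (\<lambda>\<theta>. \<theta> \<in> \<Theta>) (\<theta>t y)"
    and "is_arg_max (\<lambda>\<theta>. \<integral>y. L y \<theta> \<partial>M) (\<lambda>\<theta>. \<theta> \<in> \<Theta>) \<theta>s"
    and "GDERIV (\<lambda>\<theta>. \<integral>y. L y \<theta> \<partial>M) \<theta>s :> 0"
    and "\<And>y. y \<in> space M \<Longrightarrow> stoch_comp M L y differentiable_on \<Theta>"
    and "sym_pos_def V2" and "g > 0" and "\<nu>0 \<ge> 1" and "r0 > 0"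
    and "local_set V2 \<theta>s r0 \<subseteq> \<Theta>"
    and "r \<le> r0"
    and "0 \<le> \<omega>r" and "\<omega>r \<le> 1/2"
    and "exp_moment_cond M \<Theta> L \<theta>s V2 g \<nu>0 r \<omega>r"
    and "sym_pos_def D2"
    and "0 \<le> \<delta>r" and "\<delta>r \<le> 1/2"
    and "\<And>\<theta>. \<theta> \<in> local_set V2 \<theta>s r \<Longrightarrow> \<theta> \<noteq> \<theta>s \<Longrightarrow>
      \<bar>(- 2 * (\<integral>y. L y \<theta> - L y \<theta>s \<partial>M)) / (norm (mat_sqrt D2 *v (\<theta> - \<theta>s)))\<^sup>2 - 1\<bar> \<le> \<delta>r"
    and "\<rho> \<ge> 3 * \<nu>0 * \<omega>r" and "\<delta> \<ge> \<delta>r"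
    and "sym_pos_def (D_eps2 D2 V2 \<delta> \<rho>)"
    and "z > 0"
  shows "measure M {y \<in> space M. norm (D_eps D2 V2 \<delta> \<rho> *v (\<theta>t y - \<theta>s)) > z \<and>
                       y \<in> C_event M \<Theta> L \<theta>s \<theta>t D2 V2 \<delta> \<rho> r}
       \<le> measure M {y \<in> space M. norm (xi_eps \<Theta> L \<theta>s D2 V2 \<delta> \<rho> y)
                       > z - sqrt (2 * spread M \<Theta> L \<theta>s D2 V2 \<delta> \<rho> r y)}"
    (is "measure M ?A \<le> measure M ?B")
proof -
  interpret prob_space M by fact
  note int = assms(2) and argmax = assms(4) and diff = assms(7) and V2 = assms(8) and D2 = assms(17)
    and ratio = assms(20) and Dup = assms(23)
  define K where "K = local_set V2 \<theta>s r"
  define \<zeta> where "\<zeta> = stoch_comp M L"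
  define EL where "EL \<theta> = (\<integral>y. L y \<theta> \<partial>M)" for \<theta>
  define G where "G y = grad \<Theta> (L y) \<theta>s" for y
  define Q where "Q \<theta> = (norm (mat_sqrt V2 *v (\<theta> - \<theta>s)))\<^sup>2" for \<theta>
  have "0 \<le> 3 * \<nu>0 * \<omega>r" using assms(10,14) by simp
  then have \<rho>: "0 \<le> \<rho>" using assms(21) by linarith
  have \<delta>: "0 \<le> \<delta>" using assms(18,22) by linarith
  have Dlow: "sym_pos_def (D_eps2 D2 V2 (- \<delta>) (- \<rho>))"
    using D2 V2 \<delta> \<rho> by (rule sym_pos_def_D_eps2_lower)
  have K: "compact K" unfolding K_def by (rule compact_local_set[OF V2])
  have K\<Theta>: "K \<subseteq> \<Theta>" using assms(12,13) unfolding K_def local_set_def by auto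
  have int\<Theta>: "\<theta>s \<in> interior \<Theta>"
    using center_in_interior_local_set[OF assms(11)] interior_mono[OF assms(12)] by blast
  then have s\<Theta>: "\<theta>s \<in> \<Theta>" using interior_subset by blast
  have L: "L y \<theta> = \<zeta> y \<theta> + EL \<theta>" for y \<theta>
    by (simp add: \<zeta>_def EL_def stoch_comp_def)
  have diff_s: "\<zeta> y differentiable (at \<theta>s within \<Theta>)" if "y \<in> space M" for y
    using diff[OF that] s\<Theta> by (simp add: \<zeta>_def differentiable_on_def)
  \<comment> \<open>The gradient of the expected log-likelihood vanishes at \<open>\<theta>s\<close>.\<close>
  have G: "grad \<Theta> (\<zeta> y) \<theta>s = G y" if "y \<in> space M" for y
  proof -
    have "GDERIV (\<lambda>\<theta>. \<zeta> y \<theta> + EL \<theta>) \<theta>s :> grad \<Theta> (\<zeta> y) \<theta>s + 0"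
      using GDERIV_grad[OF int\<Theta> diff_s[OF that]] assms(6) unfolding EL_def by (rule GDERIV_add)
    then have "GDERIV (L y) \<theta>s :> grad \<Theta> (\<zeta> y) \<theta>s"
      by (simp add: L[abs_def])
    then show ?thesis unfolding G_def by (rule grad_eqI[OF int\<Theta>, symmetric])
  qed
  define rem where "rem y \<theta> = (\<zeta> y \<theta> - \<zeta> y \<theta>s) - (\<theta> - \<theta>s) \<bullet> grad \<Theta> (\<zeta> y) \<theta>s" for y \<theta>
  have up: "diamond_up M \<Theta> L \<theta>s V2 \<rho> r y = (SUP \<theta>\<in>K. rem y \<theta> - \<rho> / 2 * Q \<theta>)" for y
    by (simp add: diamond_up_def K_def rem_def Q_def \<zeta>_def)
  have low: "diamond_low M \<Theta> L \<theta>s V2 \<rho> r y = (SUP \<theta>\<in>K. - rem y \<theta> - \<rho> / 2 * Q \<theta>)" for y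
    by (simp add: diamond_low_def K_def rem_def Q_def \<zeta>_def algebra_simps)
  have cont_rem: "continuous_on K (rem y)" if "y \<in> space M" for y
  proof -
    have "continuous_on K (\<zeta> y)"
      using differentiable_imp_continuous_on[OF diff[OF that]] K\<Theta>
      unfolding \<zeta>_def by (rule continuous_on_subset)
    then show ?thesis unfolding rem_def[abs_def] by (intro continuous_intros)
  qed
  have cont_Q: "continuous_on K Q"
    unfolding Q_def[abs_def] by (intro continuous_on_power continuous_on_norm_matrix_vector_mult)
  have cont_up: "continuous_on K (\<lambda>\<theta>. rem y \<theta> - \<rho> / 2 * Q \<theta>)"
    and cont_low: "continuous_on K (\<lambda>\<theta>. - rem y \<theta> - \<rho> / 2 * Q \<theta>)" if "y \<in> space M" for y
    by (intro continuous_intros cont_rem[OF that] cont_Q)+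
  have meas_\<zeta>: "(\<lambda>y. \<zeta> y \<theta>) \<in> borel_measurable M" if "\<theta> \<in> \<Theta>" for \<theta>
    unfolding \<zeta>_def stoch_comp_def using borel_measurable_integrable[OF int[OF that]] by measurable
  have meas_grad: "(\<lambda>y. grad \<Theta> (\<zeta> y) \<theta>s) \<in> borel_measurable M"
    by (rule borel_measurable_grad[OF int\<Theta> meas_\<zeta> diff_s])
  then have meas_G: "G \<in> borel_measurable M"
    using measurable_cong[of M "\<lambda>y. grad \<Theta> (\<zeta> y) \<theta>s" G borel] G by simp
  have meas_xi [measurable]: "xi_eps \<Theta> L \<theta>s D2 V2 \<delta>' \<rho>' \<in> borel_measurable M" for \<delta>' \<rho>'
    unfolding xi_eps_def[abs_def] G_def[symmetric]
    by (rule measurable_compose[OF meas_G])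
      (rule borel_measurable_continuous_onI[OF matrix_vector_mult_linear_continuous_on])
  have meas_rem: "(\<lambda>y. rem y \<theta>) \<in> borel_measurable M" if "\<theta> \<in> K" for \<theta>
    unfolding rem_def using meas_\<zeta>[of \<theta>] meas_\<zeta>[OF s\<Theta>] meas_grad that K\<Theta> by auto
  have [measurable]: "diamond_up M \<Theta> L \<theta>s V2 \<rho> r \<in> borel_measurable M"
    unfolding up[abs_def]
    by (rule borel_measurable_SUP_compact[OF K _ cont_up])
      (intro borel_measurable_diff borel_measurable_const meas_rem)
  have [measurable]: "diamond_low M \<Theta> L \<theta>s V2 \<rho> r \<in> borel_measurable M"
    unfolding low[abs_def]
    by (rule borel_measurable_SUP_compact[OF K _ cont_low])
      (intro borel_measurable_diff borel_measurable_uminus borel_measurable_const meas_rem)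
  have "?B \<in> sets M" unfolding spread_def by measurable
  have EL_bounds: "- ((1 + \<delta>) * ((\<theta> - \<theta>s) \<bullet> (D2 *v (\<theta> - \<theta>s))) / 2) \<le> EL \<theta> - EL \<theta>s \<and>
      EL \<theta> - EL \<theta>s \<le> - ((1 - \<delta>) * ((\<theta> - \<theta>s) \<bullet> (D2 *v (\<theta> - \<theta>s))) / 2)"
    if "\<theta> \<in> K" for \<theta>
  proof (cases "\<theta> = \<theta>s")
    case False
    have "(\<integral>y. L y \<theta> - L y \<theta>s \<partial>M) = EL \<theta> - EL \<theta>s"
      unfolding EL_def using that K\<Theta> s\<Theta> by (intro Bochner_Integration.integral_diff int) auto
    then have r: "\<bar>(- 2 * (EL \<theta> - EL \<theta>s)) / ((\<theta> - \<theta>s) \<bullet> (D2 *v (\<theta> - \<theta>s))) - 1\<bar> \<le> \<delta>r"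
      using ratio[OF that[unfolded K_def] False] by (simp only: norm_mat_sqrt_square[OF D2])
    have "0 < (\<theta> - \<theta>s) \<bullet> (D2 *v (\<theta> - \<theta>s))"
      using D2 False by (simp add: sym_pos_def_def)
    from quadratic_ratio_bounds[OF this r assms(22)] show ?thesis by blast
  qed simp
  have "?A \<subseteq> ?B"
  proof
    fix y assume yA: "y \<in> ?A"
    then have y: "y \<in> space M" and z: "z < norm (D_eps D2 V2 \<delta> \<rho> *v (\<theta>t y - \<theta>s))"
      and tK: "\<theta>t y \<in> K" by (auto simp: C_event_def K_def)
    \<comment> \<open>The maximizer of the lower quadratic function, relative to \<open>\<theta>s\<close>.\<close>
    define w where "w = matrix_inv (D_eps D2 V2 (- \<delta>) (- \<rho>)) *v xi_eps \<Theta> L \<theta>s D2 V2 (- \<delta>) (- \<rho>) y"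
    have wK: "\<theta>s + w \<in> K"
      using yA by (simp add: C_event_def K_def local_set_def w_def)
    define l where "l u = L y (\<theta>s + u) - L y \<theta>s" for u
    have l: "l u = rem y (\<theta>s + u) + u \<bullet> G y + (EL (\<theta>s + u) - EL \<theta>s)" for u
      by (simp add: l_def L rem_def G[OF y])
    have Q: "Q (\<theta>s + u) = u \<bullet> (V2 *v u)" for u
      by (simp add: Q_def norm_mat_sqrt_square[OF V2])
    have upper: "l u \<le> u \<bullet> G y - u \<bullet> (D_eps2 D2 V2 \<delta> \<rho> *v u) / 2 + diamond_up M \<Theta> L \<theta>s V2 \<rho> r y"
      if "\<theta>s + u \<in> K" for u
    proof -
      have "rem y (\<theta>s + u) - \<rho> / 2 * (u \<bullet> (V2 *v u)) \<le> diamond_up M \<Theta> L \<theta>s V2 \<rho> r y"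
        using le_SUP_compact[OF K cont_up[OF y] that] by (simp add: up Q)
      with EL_bounds[OF that] show ?thesis
        unfolding l D_eps2_quadratic_form by (simp add: field_simps)
    qed
    have lower: "u \<bullet> G y - u \<bullet> (D_eps2 D2 V2 (- \<delta>) (- \<rho>) *v u) / 2 - diamond_low M \<Theta> L \<theta>s V2 \<rho> r y \<le> l u"
      if "\<theta>s + u \<in> K" for u
    proof -
      have "- rem y (\<theta>s + u) - \<rho> / 2 * (u \<bullet> (V2 *v u)) \<le> diamond_low M \<Theta> L \<theta>s V2 \<rho> r y"
        using le_SUP_compact[OF K cont_low[OF y] that] by (simp add: low Q)
      with EL_bounds[OF that] show ?thesis
        unfolding l D_eps2_quadratic_form by (simp add: field_simps)
    qed
    have max: "l w \<le> l (\<theta>t y - \<theta>s)"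
      using argmax[OF y] wK K\<Theta> by (auto simp: l_def is_arg_max_linorder)
    have tK': "\<theta>s + (\<theta>t y - \<theta>s) \<in> K" using tK by simp
    have w: "w = matrix_inv (mat_sqrt (D_eps2 D2 V2 (- \<delta>) (- \<rho>)))
        *v (matrix_inv (mat_sqrt (D_eps2 D2 V2 (- \<delta>) (- \<rho>))) *v G y)"
      by (simp add: w_def xi_eps_def D_eps_def G_def)
    have "norm (D_eps D2 V2 \<delta> \<rho> *v (\<theta>t y - \<theta>s)) \<le>
        norm (xi_eps \<Theta> L \<theta>s D2 V2 \<delta> \<rho> y) + sqrt (2 * spread M \<Theta> L \<theta>s D2 V2 \<delta> \<rho> r y)"
      unfolding spread_def xi_eps_def D_eps_def G_def[symmetric]
      by (rule bracketed_maximizer_bound[where l = l, OF Dup Dlow upper[OF tK']])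
        (use lower[OF wK] max in \<open>simp_all only: w[symmetric]\<close>)
    with y z show "y \<in> ?B" by simp
  qed
  then show ?thesis using \<open>?B \<in> sets M\<close> by (rule finite_measure_mono)
qed

end
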